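(* Let $(G,\mu)$ be a measured group, and let $(Z,m)$ and $(\check Z,\check m)$ denote the Poisson boundaries of $(G,\mu)$ and $(G,\check\mu)$ respectively. Let $(Y,\eta)$ be an ergodic probability measure-preserving $G$-space. Then the diagonal action $G\curvearrowright (Z\times\check Z\times Y, m\otimes\check m\otimes\eta)$ is ergodic.
   Context: A measured group is a pair $(G,\mu)$, where $G$ is a countable group and $\mu$ is a probability measure on $G$ whose support generates $G$ as a semi-group. The adjoint measure is $\check\mu(s)=\mu(s^{-1})$. All $G$-spaces are Borel probability measure spaces $(X,\nu)$ equipped with an action of $G$ by measurable maps with measurable inverses which preserve the class of $\nu$-null sets. The action is ergodic if every Borel set $B\subset X$ with $\nu(B\,\Delta\, gB)=0$ for all $g\in G$ is $\nu$-null or $\nu$-conull. For a probability measure $p$ on $G$, $(X,\nu)$ is a $(G,p)$-space if $\sum_{s\in G}\big(\int_X f(sx)\,d\nu(x)\big)p(s)=\int_X f\,d\nu$ for all $f\in L^\infty(X,\nu)$. For a measured group $(G,p)$, $H^\infty(G,p)$ is the Banach space (supremum norm) of bounded real-valued functions $u$ on $G$ satisfying $\sum_s u(gs)p(s)=u(g)$ for all $g\in G$. The Poisson boundary of $(G,p)$ is the ergodic $(G,p)$-space $(Z,m)$, which exists and is unique up to $G$-equivariant measurable isomorphism by a theorem of Furstenberg, such that the map $P_m:L^\infty(Z,m)\to H^\infty(G,p)$, $P_mf(s)=\int_Z f(sz)\,dm(z)$, is an isometric isomorphism of Banach spaces. Here $L^\infty$ denotes real-valued essentially bounded functions modulo null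 sets. *)

theory Defs
  imports "HOL-Probability.Probability" "HOL-Algebra.Group_Action"
begin

section \<open>Measured groups\<close>

inductive_set semigroup_span :: "('g, 'r) monoid_scheme \<Rightarrow> 'g set \<Rightarrow> 'g set"
  for G (structure) and S where
  incl: "s \<in> S \<Longrightarrow> s \<in> semigroup_span G S"
| mult: "\<lbrakk>s \<in> semigroup_span G S; t \<in> semigroup_span G S\<rbrakk> \<Longrightarrow> s \<otimes> t \<in> semigroup_span G S"

locale measured_group = group G for G (structure) +
  fixes p :: "'a pmf"
  assumes countable_carrier: "countable (carrier G)"
    and support_subset: "set_pmf p \<subseteq> carrier G"
    and support_generates: "semigroup_span G (set_pmf p) = carrier G"

definition adjoint_pmf :: "('g, 'r) monoid_scheme \<Rightarrow> 'g pmf \<Rightarrow> 'g pmf" where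
  "adjoint_pmf G p = map_pmf (\<lambda>s. inv\<^bsub>G\<^esub> s) p"

lemma (in group) pmf_adjoint_pmf:
  assumes "set_pmf p \<subseteq> carrier G" "s \<in> carrier G"
  shows "pmf (adjoint_pmf G p) s = pmf p (inv s)"
proof (cases "inv s \<in> set_pmf p")
  case True
  have "inj_on (\<lambda>s. inv s) (set_pmf p)"
    using assms(1) inv_inj inj_on_subset by blast
  then have "pmf (map_pmf (\<lambda>s. inv s) p) (inv (inv s)) = pmf p (inv s)"
    using True by (rule pmf_map_inj)
  then show ?thesis
    using assms(2) by (simp add: adjoint_pmf_def)
next
  case False
  then have "s \<notin> set_pmf (adjoint_pmf G p)"
    using assms by (auto simp: adjoint_pmf_def)
  with False show ?thesis
    by (metis pmf_eq_0_set_pmf)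
qed


section \<open>Spaces with a measure-class preserving action\<close>

text \<open>
  A space is an arbitrary probability space; its sigma-algebra is not required to be standard.
  As \<^const>\<open>BijGroup\<close> consists of extensional functions, so does every action; this only
  fixes the values outside \<^term>\<open>space M\<close>.
\<close>

locale G_space = group_action G "space M" \<phi> + prob_space M
  for G :: "('g, 'r) monoid_scheme" (structure) and M :: "'x measure" and \<phi> :: "'g \<Rightarrow> 'x \<Rightarrow> 'x" +
  assumes action_measurable: "g \<in> carrier G \<Longrightarrow> \<phi> g \<in> M \<rightarrow>\<^sub>M M"
    and action_null_sets:
      "\<lbrakk>g \<in> carrier G; B \<in> sets M\<rbrakk> \<Longrightarrow> \<phi> g ` B \<in> null_sets M \<longleftrightarrow> B \<in> null_sets M"

locale ergodic_G_space = G_space +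
  assumes ergodic:
    "\<lbrakk>B \<in> sets M; \<And>g. g \<in> carrier G \<Longrightarrow> sym_diff B (\<phi> g ` B) \<in> null_sets M\<rbrakk>
      \<Longrightarrow> B \<in> null_sets M \<or> space M - B \<in> null_sets M"

locale pmp_G_space = G_space +
  assumes measure_preserving: "g \<in> carrier G \<Longrightarrow> distr M M (\<phi> g) = M"

definition diagonal_action ::
  "'x measure \<Rightarrow> ('g \<Rightarrow> 'x \<Rightarrow> 'x) \<Rightarrow> 'y measure \<Rightarrow> ('g \<Rightarrow> 'y \<Rightarrow> 'y) \<Rightarrow> 'g \<Rightarrow> 'x \<times> 'y \<Rightarrow> 'x \<times> 'y"
where
  "diagonal_action M \<phi> N \<psi> = (\<lambda>g. restrict (map_prod (\<phi> g) (\<psi> g)) (space (M \<Otimes>\<^sub>M N)))"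


section \<open>Stationary spaces and the Poisson boundary\<close>

text \<open>
  Elements of \<open>L\<^sup>\<infinity>\<close> are represented by functions, and \<open>Linf_norm\<close> is a seminorm vanishing exactly
  on the functions that are zero almost everywhere.
\<close>

definition Linf_norm :: "'x measure \<Rightarrow> ('x \<Rightarrow> real) \<Rightarrow> real" where
  "Linf_norm M f = real_of_ereal (esssup M (\<lambda>x. ereal \<bar>f x\<bar>))"

definition Linf :: "'x measure \<Rightarrow> ('x \<Rightarrow> real) set" where
  "Linf M = {f \<in> borel_measurable M. esssup M (\<lambda>x. ereal \<bar>f x\<bar>) < \<infinity>}"

locale stationary_G_space = G_space +
  fixes p :: "'a pmf"
  assumes stationary: "f \<in> Linf M \<Longrightarrow>
    ((\<lambda>s. (\<integral>x. f (\<phi> s x) \<partial>M) * pmf p s) has_sum (\<integral>x. f x \<partial>M)) (carrier G)"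

text \<open>Real functions on the group are represented by extensional functions on its carrier.\<close>

definition Hinf :: "('g, 'r) monoid_scheme \<Rightarrow> 'g pmf \<Rightarrow> ('g \<Rightarrow> real) set" where
  "Hinf G p = {u \<in> extensional (carrier G). bounded (u ` carrier G) \<and>
     (\<forall>g\<in>carrier G. ((\<lambda>s. u (g \<otimes>\<^bsub>G\<^esub> s) * pmf p s) has_sum u g) (carrier G))}"

definition Hinf_norm :: "('g, 'r) monoid_scheme \<Rightarrow> ('g \<Rightarrow> real) \<Rightarrow> real" where
  "Hinf_norm G u = (SUP s\<in>carrier G. \<bar>u s\<bar>)"

definition poisson_map ::
  "('g, 'r) monoid_scheme \<Rightarrow> 'x measure \<Rightarrow> ('g \<Rightarrow> 'x \<Rightarrow> 'x) \<Rightarrow> ('x \<Rightarrow> real) \<Rightarrow> 'g \<Rightarrow> real"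
where
  "poisson_map G M \<phi> f = (\<lambda>s\<in>carrier G. \<integral>x. f (\<phi> s x) \<partial>M)"

text \<open>
  The last three assumptions say that \<open>poisson_map\<close> induces an isometric isomorphism from the
  quotient of \<open>Linf M\<close> by almost everywhere equality onto \<open>Hinf G p\<close>: being linear and
  isometric, it is well defined and injective on the quotient.
\<close>

locale poisson_boundary =
  measured_group G p + ergodic_G_space G M \<phi> + stationary_G_space G M \<phi> p
  for G :: "('g, 'r) monoid_scheme" (structure) and p :: "'g pmf"
    and M :: "'x measure" and \<phi> :: "'g \<Rightarrow> 'x \<Rightarrow> 'x" +
  assumes poisson_map_linear: "\<lbrakk>f \<in> Linf M; h \<in> Linf M\<rbrakk> \<Longrightarrow>
      poisson_map G M \<phi> (\<lambda>x. a * f x + b * h x) =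
        (\<lambda>s\<in>carrier G. a * poisson_map G M \<phi> f s + b * poisson_map G M \<phi> h s)"
    and poisson_map_isometric: "f \<in> Linf M \<Longrightarrow> Hinf_norm G (poisson_map G M \<phi> f) = Linf_norm M f"
    and poisson_map_image: "poisson_map G M \<phi> ` Linf M = Hinf G p"

end

theory Submission
  imports Defs
begin

text \<open>
  Let $Z$ be the Poisson boundary of the adjoint of $p$ and $N$ an ergodic $(G,p)$-space. For an
  invariant set $B \subseteq Z \times N$ put $h(y) = \int 1_B(x,y)\,dx$. Invariance identifies the
  Poisson transform of $1_B(\cdot,y)$ with $g \mapsto h(g^{-1}y)$, so $h$ is $p$-harmonic on $N$;
  as $N$ is stationary, the mean square of $h(sy) - h(y)$ vanishes, so $h$ is invariant and hence a
  constant $c$. Since constants are the transforms of constants, injectivity of the Poisson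
  transform gives $1_B = c$ almost everywhere. Applying this first to $\check Z$ and $Y$, and then to
  $Z$ and the stationary space $\check Z \times Y$, yields the theorem.
\<close>

section \<open>Unordered sums, essentially bounded functions and the adjoint measure\<close>

lemma nn_integral_count_space_has_sum:
  fixes f :: "'a \<Rightarrow> real"
  assumes "(f has_sum a) A" and "\<And>x. x \<in> A \<Longrightarrow> f x \<ge> 0"
  shows "(\<integral>\<^sup>+x. ennreal (f x) \<partial>count_space A) = ennreal a"
proof -
  have "f summable_on A"
    using assms(1) by (auto simp: summable_on_def)
  then have "(\<lambda>x. norm (f x)) summable_on A"
    using assms(2) by (simp cong: summable_on_cong)
  then have "Infinite_Set_Sum.abs_summable_on f A"
    using abs_summable_equivalent by blast
  then show ?thesis
    using assms(2) infsetsum_infsum[of f A] infsumI[OF assms(1)]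
    by (simp add: nn_integral_conv_infsetsum)
qed

lemma has_sum_pmf:
  assumes "set_pmf p \<subseteq> A"
  shows "(pmf p has_sum 1) A"
proof -
  have "Infinite_Set_Sum.abs_summable_on (pmf p) A"
    by (rule pmf_abs_summable)
  then have "infsum (pmf p) A = 1" and "pmf p summable_on A"
    using infsetsum_infsum[of "pmf p" A] infsetsum_pmf_eq_1[OF assms]
      abs_summable_equivalent[of "pmf p" A] abs_summable_summable[of "pmf p" A] by auto
  then show ?thesis
    by (metis has_sum_infsum)
qed

text \<open>Trades the essential supremum for an explicit bound \<open>C\<close>, the form in which
  membership in \<open>Linf\<close> is checked below.\<close>

lemma Linf_iff:
  "f \<in> Linf M \<longleftrightarrow> f \<in> borel_measurable M \<and> (\<exists>C. AE x in M. \<bar>f x\<bar> \<le> C)"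
proof
  assume f: "f \<in> Linf M"
  then obtain C :: real where C: "esssup M (\<lambda>x. ereal \<bar>f x\<bar>) \<le> ereal C"
    by (cases "esssup M (\<lambda>x. ereal \<bar>f x\<bar>)") (auto simp: Linf_def)
  have "AE x in M. \<bar>f x\<bar> \<le> C"
    using esssup_AE[of "\<lambda>x. ereal \<bar>f x\<bar>" M]
    by eventually_elim (use C in \<open>auto dest: order_trans\<close>)
  with f show "f \<in> borel_measurable M \<and> (\<exists>C. AE x in M. \<bar>f x\<bar> \<le> C)"
    by (auto simp: Linf_def)
next
  assume f: "f \<in> borel_measurable M \<and> (\<exists>C. AE x in M. \<bar>f x\<bar> \<le> C)"
  then obtain C where "AE x in M. \<bar>f x\<bar> \<le> C" by auto
  then have "esssup M (\<lambda>x. ereal \<bar>f x\<bar>) \<le> ereal C"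
    using f by (intro esssup_I) auto
  with f show "f \<in> Linf M"
    by (auto simp: Linf_def le_less_trans)
qed

lemma (in prob_space) integrable_Linf:
  "f \<in> Linf M \<Longrightarrow> integrable M (f :: 'a \<Rightarrow> real)"
  unfolding Linf_iff by (auto intro!: integrable_const_bound)

text \<open>\<open>real_of_ereal\<close> also sends both infinities to 0, so the essential supremum
  must first be shown finite, by membership in \<open>Linf\<close>, and nonnegative, by total mass
  1.\<close>

lemma (in prob_space) AE_zero_of_Linf_norm:
  assumes "f \<in> Linf M" and "Linf_norm M f = 0"
  shows "AE x in M. f x = 0"
proof -
  let ?e = "esssup M (\<lambda>x. ereal \<bar>f x\<bar>)"
  have [measurable]: "f \<in> borel_measurable M"
    using assms(1) by (simp add: Linf_iff)
  have "esssup M (\<lambda>x. 0 :: ereal) \<le> ?e"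
    by (rule esssup_mono) auto
  then have "0 \<le> ?e"
    by (simp add: esssup_const emeasure_space_1)
  moreover have "?e < \<infinity>"
    using assms(1) by (simp add: Linf_def)
  ultimately have "?e = 0"
    using assms(2) by (auto simp: Linf_norm_def real_of_ereal_eq_0)
  then show ?thesis
    using esssup_AE[of "\<lambda>x. ereal \<bar>f x\<bar>" M] by simp
qed

text \<open>Lets the boundary of a measure count as the boundary of the adjoint of its adjoint, so
  that one ergodicity result serves both factors.\<close>

lemma (in group) adjoint_adjoint_pmf:
  assumes "set_pmf p \<subseteq> carrier G"
  shows "adjoint_pmf G (adjoint_pmf G p) = p"
proof -
  have "map_pmf (\<lambda>s. inv (inv s)) p = map_pmf (\<lambda>s. s) p"
    using assms by (intro map_pmf_cong) auto
  then show ?thesis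
    by (simp add: adjoint_pmf_def pmf.map_comp comp_def)
qed

lemma (in group) inv_bij_betw: "bij_betw (\<lambda>s. inv s) (carrier G) (carrier G)"
  by (rule bij_betw_byWitness[where f'="\<lambda>s. inv s"]) auto

section \<open>Group actions and quasi-invariance\<close>

context group_action
begin

lemma group_G: "group G"
  using group_hom group_hom.axioms(1) by blast

lemma action_closed: "g \<in> carrier G \<Longrightarrow> x \<in> E \<Longrightarrow> \<phi> g x \<in> E"
  using element_image by blast

lemma action_one: "x \<in> E \<Longrightarrow> \<phi> \<one> x = x"
  using id_eq_one by (metis restrict_apply')

lemma action_inv:
  assumes "g \<in> carrier G" and "x \<in> E"
  shows "\<phi> (inv g) (\<phi> g x) = x" and "\<phi> g (\<phi> (inv g) x) = x"
proof -
  interpret group G by (rule group_G)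
  show "\<phi> (inv g) (\<phi> g x) = x"
    using assms orbit_sym_aux by blast
  show "\<phi> g (\<phi> (inv g) x) = x"
    using assms orbit_sym_aux[of "inv g" x] by simp
qed

text \<open>Images are rewritten as preimages under the inverse because only preimages are known to
  be measurable.\<close>

lemma action_image_eq:
  assumes "g \<in> carrier G" and "B \<subseteq> E"
  shows "\<phi> g ` B = \<phi> (inv g) -` B \<inter> E"
proof -
  interpret group G by (rule group_G)
  have "x \<in> \<phi> g ` B" if "x \<in> E" "\<phi> (inv g) x \<in> B" for x
    using that assms by (metis action_inv(2) imageI)
  then show ?thesis
    using assms by (auto simp: action_closed action_inv subsetD)
qed

end

text \<open>One direction of quasi-invariance suffices: applied to the inverse of \<open>g\<close>
  it shows that images of null sets are null, and applied to \<open>g\<close> itself it recovers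
  \<open>B\<close> from its image by injectivity.\<close>

lemma G_spaceI:
  assumes "group_action G (space M) \<phi>" and "prob_space M"
    and meas: "\<And>g. g \<in> carrier G \<Longrightarrow> \<phi> g \<in> M \<rightarrow>\<^sub>M M"
    and null: "\<And>g B. g \<in> carrier G \<Longrightarrow> B \<in> null_sets M \<Longrightarrow> AE x in M. \<phi> g x \<notin> B"
  shows "G_space G M \<phi>"
proof -
  interpret group_action G "space M" \<phi> by fact
  interpret group G by (rule group_G)
  have null': "\<phi> g -` B \<inter> space M \<in> null_sets M" if "g \<in> carrier G" "B \<in> null_sets M" for g B
    using null[OF that] measurable_sets[OF meas[OF that(1)], of B] that(2)
    by (subst (asm) AE_iff_null) (auto simp: vimage_def Int_def conj_commute cong: conj_cong)
  have "\<phi> g ` B \<in> null_sets M \<longleftrightarrow> B \<in> null_sets M" if g: "g \<in> carrier G" and B: "B \<in> sets M" for g B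
  proof
    have sub: "B \<subseteq> space M"
      using B by (rule sets.sets_into_space)
    show "\<phi> g ` B \<in> null_sets M" if "B \<in> null_sets M"
      using null'[of "inv\<^bsub>G\<^esub> g" B] that g by (simp add: action_image_eq[OF g sub])
    assume "\<phi> g ` B \<in> null_sets M"
    then have "\<phi> g -` \<phi> g ` B \<inter> space M \<in> null_sets M"
      by (rule null'[OF g])
    moreover have "\<phi> g -` \<phi> g ` B \<inter> space M = B"
      using sub inj_prop[OF g] by (auto dest: inj_onD)
    ultimately show "B \<in> null_sets M" by simp
  qed
  then show ?thesis
    by (intro G_space.intro G_space_axioms.intro assms)
qed

context G_space
begin

lemma action_image_sets:
  assumes "g \<in> carrier G" and "B \<in> sets M"
  shows "\<phi> g ` B \<in> sets M"
proof -
  interpret group G by (rule group_G)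
  show ?thesis
    using assms by (simp add: action_image_eq sets.sets_into_space measurable_sets[OF action_measurable])
qed

lemma AE_action:
  assumes g: "g \<in> carrier G" and "AE x in M. P x"
  shows "AE x in M. P (\<phi> g x)"
proof -
  interpret group G by (rule group_G)
  obtain N where N: "\<And>x. x \<in> space M - N \<Longrightarrow> P x" "N \<in> null_sets M"
    using AE_E3[OF assms(2)] by blast
  have "\<phi> (inv g) ` N \<in> null_sets M"
    using N(2) g action_null_sets[of "inv g" N] by (simp add: null_setsD2)
  moreover have "x \<in> \<phi> (inv g) ` N" if "x \<in> space M" "\<not> P (\<phi> g x)" for x
  proof
    show "x = \<phi> (inv g) (\<phi> g x)" "\<phi> g x \<in> N"
      using that g N(1) action_closed[OF g] by (auto simp: action_inv)
  qed
  ultimately show ?thesis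
    by (intro AE_I'[of "\<phi> (inv g) ` N"]) auto
qed

lemma Linf_action:
  assumes "g \<in> carrier G" and "f \<in> Linf M"
  shows "(\<lambda>x. f (\<phi> g x)) \<in> Linf M"
proof -
  obtain C where "AE x in M. \<bar>f x\<bar> \<le> C" "f \<in> borel_measurable M"
    using assms(2) by (auto simp: Linf_iff)
  then show ?thesis
    using AE_action[OF assms(1), of "\<lambda>x. \<bar>f x\<bar> \<le> C"] measurable_compose[OF action_measurable[OF assms(1)]]
    by (auto simp: Linf_iff)
qed

text \<open>The symmetric difference for \<open>g\<close> is where membership in \<open>B\<close>
  changes under the inverse of \<open>g\<close>; quantifying over the whole group absorbs the
  inversion.\<close>

lemma invariant_iff_AE:
  assumes "B \<in> sets M"
  shows "(\<forall>g\<in>carrier G. sym_diff B (\<phi> g ` B) \<in> null_sets M)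
    \<longleftrightarrow> (\<forall>g\<in>carrier G. AE x in M. \<phi> g x \<in> B \<longleftrightarrow> x \<in> B)"
proof -
  interpret group G by (rule group_G)
  have B: "B \<subseteq> space M"
    using assms by (rule sets.sets_into_space)
  have *: "sym_diff B (\<phi> g ` B) \<in> null_sets M \<longleftrightarrow> (AE x in M. \<phi> (inv g) x \<in> B \<longleftrightarrow> x \<in> B)"
    if g: "g \<in> carrier G" for g
  proof -
    have "sym_diff B (\<phi> g ` B) = {x \<in> space M. \<not> (\<phi> (inv g) x \<in> B \<longleftrightarrow> x \<in> B)}"
      unfolding action_image_eq[OF g B] using B by auto
    moreover have "sym_diff B (\<phi> g ` B) \<in> sets M"
      using assms action_image_sets[OF g assms] by auto
    ultimately show ?thesis
      by (simp add: AE_iff_null)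
  qed
  have "(\<forall>g\<in>carrier G. Q (inv g)) \<longleftrightarrow> (\<forall>g\<in>carrier G. Q g)" for Q
    by (metis inv_closed inv_inv)
  then show ?thesis
    by (simp add: *)
qed

end

section \<open>Ergodicity and almost everywhere statements\<close>

lemma (in ergodic_G_space) ergodic_AE:
  assumes "B \<in> sets M" and "\<And>g. g \<in> carrier G \<Longrightarrow> AE x in M. \<phi> g x \<in> B \<longleftrightarrow> x \<in> B"
  shows "(AE x in M. x \<notin> B) \<or> (AE x in M. x \<in> B)"
proof -
  have "B \<in> null_sets M \<or> space M - B \<in> null_sets M"
    using assms invariant_iff_AE[OF assms(1)] by (intro ergodic) auto
  then show ?thesis
  proof
    assume "space M - B \<in> null_sets M"
    then have "AE x in M. x \<in> B"
      by (rule AE_I') auto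
    then show ?thesis ..
  qed (auto intro: AE_not_in)
qed

text \<open>It suffices to compare \<open>h\<close> with its mean. The sets where \<open>h\<close>
  lies below or above the mean are invariant, hence null or conull, and a conull one would make the
  mean strictly smaller or larger than itself.\<close>

lemma (in ergodic_G_space) invariant_imp_AE_const:
  fixes h :: "_ \<Rightarrow> real"
  assumes "integrable M h" and inv: "\<And>g. g \<in> carrier G \<Longrightarrow> AE x in M. h (\<phi> g x) = h x"
  shows "AE x in M. h x = (\<integral>x. h x \<partial>M)"
proof -
  let ?c = "\<integral>x. h x \<partial>M"
  have [measurable]: "h \<in> borel_measurable M"
    using assms(1) by simp
  have aux: "(AE x in M. \<not> R (h x)) \<or> (AE x in M. R (h x))" if [measurable]: "Measurable.pred borel R" for R
  proof -
    have "(AE x in M. x \<notin> {x \<in> space M. R (h x)}) \<or> (AE x in M. x \<in> {x \<in> space M. R (h x)})"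
    proof (rule ergodic_AE)
      fix g assume g: "g \<in> carrier G"
      from inv[OF g] AE_space
      show "AE x in M. \<phi> g x \<in> {x \<in> space M. R (h x)} \<longleftrightarrow> x \<in> {x \<in> space M. R (h x)}"
        by eventually_elim (use g in \<open>auto simp: action_closed\<close>)
    qed measurable
    then show ?thesis
      by (auto cong: AE_cong)
  qed
  have "\<not> (AE x in M. h x < ?c)"
  proof
    assume "AE x in M. h x < ?c"
    then have "(\<integral>x. h x \<partial>M) < (\<integral>x. ?c \<partial>M)"
      using assms(1) by (intro integral_less_AE_space) (auto simp: emeasure_space_1)
    then show False by (simp add: prob_space)
  qed
  moreover have "\<not> (AE x in M. h x > ?c)"
  proof
    assume "AE x in M. h x > ?c"
    then have "(\<integral>x. ?c \<partial>M) < (\<integral>x. h x \<partial>M)"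
      using assms(1) by (intro integral_less_AE_space) (auto simp: emeasure_space_1)
    then show False by (simp add: prob_space)
  qed
  ultimately have "AE x in M. \<not> h x < ?c" "AE x in M. \<not> h x > ?c"
    using aux[of "\<lambda>y. y < ?c"] aux[of "\<lambda>y. y > ?c"] by auto
  then show ?thesis by eventually_elim simp
qed

text \<open>\<open>P\<close> may be non-measurable, so the order of the quantifiers is exchanged for
  a measurable null set \<open>N\<close> containing its failures.\<close>

lemma (in pair_sigma_finite) AE_pair_swapped:
  assumes "AE p in M1 \<Otimes>\<^sub>M M2. P p"
  shows "AE y in M2. AE x in M1. P (x, y)"
proof -
  obtain N where N: "\<And>p. p \<in> space (M1 \<Otimes>\<^sub>M M2) - N \<Longrightarrow> P p" and "N \<in> null_sets (M1 \<Otimes>\<^sub>M M2)"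
    using AE_E3[OF assms] by blast
  then have [measurable]: "N \<in> sets (M1 \<Otimes>\<^sub>M M2)" and "AE p in M1 \<Otimes>\<^sub>M M2. p \<notin> N"
    by (auto intro: AE_not_in)
  then have "AE x in M1. AE y in M2. (x, y) \<notin> N"
    by (intro AE_pair)
  then have "AE y in M2. AE x in M1. (x, y) \<notin> N"
    using AE_commute[of "\<lambda>x y. (x, y) \<notin> N"] by simp
  then show ?thesis
    using AE_space
  proof eventually_elim
    case (elim y)
    from elim(1) AE_space show ?case
      by eventually_elim (use elim N in \<open>auto simp: space_pair_measure\<close>)
  qed
qed

section \<open>Stationary spaces and harmonic functions on them\<close>

lemma (in pmp_G_space) pmp_stationary:
  assumes "set_pmf p \<subseteq> carrier G"
  shows "stationary_G_space G M \<phi> p"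
proof (intro stationary_G_space.intro stationary_G_space_axioms.intro G_space_axioms)
  fix f assume f: "f \<in> Linf M"
  have "(\<integral>x. f (\<phi> s x) \<partial>M) = (\<integral>x. f x \<partial>M)" if "s \<in> carrier G" for s
    using f integral_distr[OF action_measurable[OF that], of f] measure_preserving[OF that]
    by (simp add: Linf_iff)
  then show "((\<lambda>s. (\<integral>x. f (\<phi> s x) \<partial>M) * pmf p s) has_sum (\<integral>x. f x \<partial>M)) (carrier G)"
    using has_sum_cmult_right[OF has_sum_pmf[OF assms], of "\<integral>x. f x \<partial>M", unfolded mult_1_right]
    by (simp cong: has_sum_cong)
qed

text \<open>By harmonicity, the \<open>p\<close>-average of (h(sx) - h(x))^2 over s is the average
  of h(sx)^2 minus h(x)^2. Stationarity for h^2 makes its integral over x vanish. This gives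
  invariance under the support of \<open>p\<close>, hence under the semigroup it generates, which is
  the whole group.\<close>

lemma (in stationary_G_space) harmonic_imp_AE_invariant:
  fixes h :: "_ \<Rightarrow> real"
  assumes "measured_group G p"
    and h [measurable]: "h \<in> borel_measurable M" and bnd: "\<And>x. x \<in> space M \<Longrightarrow> \<bar>h x\<bar> \<le> C"
    and harmonic: "AE x in M. ((\<lambda>s. h (\<phi> s x) * pmf p s) has_sum h x) (carrier G)"
    and "g \<in> carrier G"
  shows "AE x in M. h (\<phi> g x) = h x"
proof -
  interpret measured_group G p by fact
  have pmf1: "(pmf p has_sum 1) (carrier G)"
    by (rule has_sum_pmf[OF support_subset])
  have sq_bnd: "(h x)\<^sup>2 \<le> C\<^sup>2" if "x \<in> space M" for x
    using power_mono[OF bnd[OF that], of 2] by simp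
  define A where "A s x = (h (\<phi> s x) - h x)\<^sup>2 * pmf p s" for s x
  note [measurable] = action_measurable
  have A_meas: "(\<lambda>x. ennreal (A s x)) \<in> borel_measurable M" if "s \<in> carrier G" for s
    using that unfolding A_def by measurable
  have sqL: "(\<lambda>x. (h x)\<^sup>2) \<in> Linf M"
    unfolding Linf_iff using sq_bnd by (auto intro!: exI[of _ "C\<^sup>2"])
  \<comment> \<open>The term h(x)^2 stands on the left to avoid subtraction in
    \<open>ennreal\<close>.\<close>
  have variance: "AE x in M. (\<integral>\<^sup>+s. ennreal (A s x) \<partial>count_space (carrier G)) + ennreal ((h x)\<^sup>2)
      = (\<integral>\<^sup>+s. ennreal ((h (\<phi> s x))\<^sup>2 * pmf p s) \<partial>count_space (carrier G))"
    using harmonic AE_space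
  proof eventually_elim
    case (elim x)
    have "(\<lambda>s. (h (\<phi> s x))\<^sup>2 * pmf p s) summable_on carrier G"
    proof (rule summable_on_comparison_test)
      show "(\<lambda>s. C\<^sup>2 * pmf p s) summable_on carrier G"
        using has_sum_cmult_right[OF pmf1, of "C\<^sup>2"] by (auto simp: summable_on_def)
    qed (use elim(2) in \<open>auto intro!: mult_right_mono sq_bnd action_closed\<close>)
    then obtain q where q: "((\<lambda>s. (h (\<phi> s x))\<^sup>2 * pmf p s) has_sum q) (carrier G)"
      by (auto simp: summable_on_def)
    \<comment> \<open>The expanded square is summed termwise; harmonicity evaluates the cross term
      as -2 h(x) h(x).\<close>
    have "((\<lambda>s. (h (\<phi> s x))\<^sup>2 * pmf p s + ((-2 * h x) * (h (\<phi> s x) * pmf p s) + (h x)\<^sup>2 * pmf p s))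
        has_sum (q + ((-2 * h x) * h x + (h x)\<^sup>2 * 1))) (carrier G)"
      by (intro has_sum_add has_sum_cmult_right q elim(1) pmf1)
    moreover have "(h (\<phi> s x))\<^sup>2 * pmf p s + ((-2 * h x) * (h (\<phi> s x) * pmf p s) + (h x)\<^sup>2 * pmf p s) = A s x" for s
      by (simp add: A_def power2_eq_square algebra_simps)
    ultimately have A: "((\<lambda>s. A s x) has_sum (q - (h x)\<^sup>2)) (carrier G)"
      by (simp add: power2_eq_square)
    have "0 \<le> q - (h x)\<^sup>2"
      by (rule has_sum_nonneg[OF A]) (simp add: A_def)
    then show ?case
      using nn_integral_count_space_has_sum[OF A] nn_integral_count_space_has_sum[OF q]
      by (simp add: A_def flip: ennreal_plus)
  qed
  \<comment> \<open>Tonelli over the countable group, followed by stationarity applied to the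
    bounded function h^2.\<close>
  have "(\<integral>\<^sup>+x. \<integral>\<^sup>+s. ennreal ((h (\<phi> s x))\<^sup>2 * pmf p s) \<partial>count_space (carrier G) \<partial>M)
      = (\<integral>\<^sup>+s. \<integral>\<^sup>+x. ennreal ((h (\<phi> s x))\<^sup>2 * pmf p s) \<partial>M \<partial>count_space (carrier G))"
    by (rule nn_integral_count_space_nn_integral[OF countable_carrier]) measurable
  also have "\<dots> = (\<integral>\<^sup>+s. ennreal ((\<integral>x. (h (\<phi> s x))\<^sup>2 \<partial>M) * pmf p s) \<partial>count_space (carrier G))"
    using Linf_action[OF _ sqL]
    by (intro nn_integral_cong) (simp add: nn_integral_eq_integral integrable_Linf)
  also have "\<dots> = ennreal (\<integral>x. (h x)\<^sup>2 \<partial>M)"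
    by (rule nn_integral_count_space_has_sum[OF stationary[OF sqL]]) simp
  also have "\<dots> = (\<integral>\<^sup>+x. ennreal ((h x)\<^sup>2) \<partial>M)"
    using integrable_Linf[OF sqL] by (simp add: nn_integral_eq_integral)
  finally have swap: "(\<integral>\<^sup>+x. \<integral>\<^sup>+s. ennreal ((h (\<phi> s x))\<^sup>2 * pmf p s) \<partial>count_space (carrier G) \<partial>M)
      = (\<integral>\<^sup>+x. ennreal ((h x)\<^sup>2) \<partial>M)" .
  \<comment> \<open>Finiteness permits cancelling this integral on both sides in
    \<open>ennreal\<close>.\<close>
  have fin: "(\<integral>\<^sup>+x. ennreal ((h x)\<^sup>2) \<partial>M) \<noteq> \<infinity>"
    using integrable_Linf[OF sqL] by (simp add: nn_integral_eq_integral)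
  \<comment> \<open>A single summand \<open>A s x\<close> is at most the full sum in
    \<open>variance\<close>, and \<open>swap\<close> leaves no room for it.\<close>
  have A0: "(\<integral>\<^sup>+x. ennreal (A s x) \<partial>M) = 0" if s: "s \<in> carrier G" for s
  proof -
    have "(\<integral>\<^sup>+x. ennreal (A s x) \<partial>M) + (\<integral>\<^sup>+x. ennreal ((h x)\<^sup>2) \<partial>M)
        = (\<integral>\<^sup>+x. ennreal (A s x) + ennreal ((h x)\<^sup>2) \<partial>M)"
      using A_meas[OF s] by (subst nn_integral_add) auto
    also have "\<dots> \<le> (\<integral>\<^sup>+x. \<integral>\<^sup>+s. ennreal ((h (\<phi> s x))\<^sup>2 * pmf p s) \<partial>count_space (carrier G) \<partial>M)"
      using variance
      by (intro nn_integral_mono_AE, elim eventually_mono)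
        (metis add_right_mono nn_integral_ge_point[OF s])
    finally show ?thesis
      using fin unfolding swap by (metis add_0 ennreal_add_left_cancel_le add.commute le_zero_eq infinity_ennreal_def)
  qed
  have supp: "AE x in M. h (\<phi> s x) = h x" if s: "s \<in> set_pmf p" for s
  proof -
    have "s \<in> carrier G" using s support_subset by auto
    then have "AE x in M. ennreal (A s x) = 0"
      using A0 A_meas by (subst nn_integral_0_iff_AE[symmetric]) auto
    then show ?thesis
      using s by (auto simp: A_def ennreal_eq_0_iff mult_le_0_iff set_pmf_iff elim!: eventually_mono)
  qed
  have "g \<in> semigroup_span G (set_pmf p)"
    using \<open>g \<in> carrier G\<close> by (simp add: support_generates)
  then show ?thesis
  proof induction
    case (mult s t)
    then have st: "s \<in> carrier G" "t \<in> carrier G"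
      by (auto simp: support_generates)
    from AE_action[OF st(2) mult.IH(1)] mult.IH(2) AE_space
    show ?case
      by eventually_elim (use st in \<open>simp add: composition_rule\<close>)
  qed (rule supp)
qed

section \<open>Diagonal actions on products\<close>

lemma diagonal_action_apply:
  "x \<in> space M \<Longrightarrow> y \<in> space N \<Longrightarrow> diagonal_action M \<phi> N \<psi> g (x, y) = (\<phi> g x, \<psi> g y)"
  by (simp add: diagonal_action_def space_pair_measure)

locale G_space_pair = M: G_space G M \<phi> + N: G_space G N \<psi>
  for G :: "('g, 'r) monoid_scheme" (structure) and M :: "'x measure" and \<phi>
    and N :: "'y measure" and \<psi>
begin

abbreviation "D \<equiv> diagonal_action M \<phi> N \<psi>"

sublocale P: pair_prob_space M N ..

lemma diagonal_group_action: "group_action G (space (M \<Otimes>\<^sub>M N)) D"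
proof -
  interpret group G by (rule M.group_G)
  have Bij: "D g \<in> Bij (space (M \<Otimes>\<^sub>M N))" if g: "g \<in> carrier G" for g
  proof -
    have "bij_betw (D g) (space (M \<Otimes>\<^sub>M N)) (space (M \<Otimes>\<^sub>M N))"
      by (rule bij_betw_byWitness[where f'="D (inv g)"])
        (use g in \<open>auto simp: space_pair_measure diagonal_action_apply
          M.action_closed N.action_closed M.action_inv N.action_inv\<close>)
    then show ?thesis
      by (simp add: Bij_def diagonal_action_def)
  qed
  have "D (g \<otimes> h) = compose (space (M \<Otimes>\<^sub>M N)) (D g) (D h)" if "g \<in> carrier G" "h \<in> carrier G" for g h
    using that
    by (auto simp: compose_def fun_eq_iff diagonal_action_def space_pair_measure
        M.composition_rule N.composition_rule M.action_closed N.action_closed)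
  with Bij have "D \<in> hom G (BijGroup (space (M \<Otimes>\<^sub>M N)))"
    by (auto simp: hom_def BijGroup_def)
  then show ?thesis
    by (intro group_action.intro group_hom.intro group_hom_axioms.intro group_BijGroup is_group)
qed

lemma diagonal_measurable:
  assumes "g \<in> carrier G"
  shows "D g \<in> M \<Otimes>\<^sub>M N \<rightarrow>\<^sub>M M \<Otimes>\<^sub>M N"
proof -
  note [measurable] = M.action_measurable[OF assms] N.action_measurable[OF assms]
  have "(\<lambda>p. (\<phi> g (fst p), \<psi> g (snd p))) \<in> M \<Otimes>\<^sub>M N \<rightarrow>\<^sub>M M \<Otimes>\<^sub>M N"
    by measurable
  then show ?thesis
    by (rule measurable_cong[THEN iffD1, rotated])
      (auto simp: space_pair_measure diagonal_action_apply)
qed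

text \<open>By Fubini a null set has null slices almost everywhere, so quasi-invariance can be used
  in one coordinate at a time: first to move x, then to move y for fixed x.\<close>

lemma G_space_diagonal: "G_space G (M \<Otimes>\<^sub>M N) D"
proof (rule G_spaceI[OF diagonal_group_action P.prob_space_axioms diagonal_measurable])
  fix g B assume g: "g \<in> carrier G" and B: "B \<in> null_sets (M \<Otimes>\<^sub>M N)"
  have [measurable]: "B \<in> sets (M \<Otimes>\<^sub>M N)" using B by auto
  note [measurable] = diagonal_measurable[OF g]
  have "AE x in M. AE y in N. (x, y) \<notin> B"
    by (rule P.AE_pair) (rule AE_not_in[OF B])
  then have "AE x in M. AE y in N. (\<phi> g x, y) \<notin> B"
    by (rule M.AE_action[OF g])
  then have "AE x in M. AE y in N. D g (x, y) \<notin> B"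
    using AE_space
  proof eventually_elim
    case (elim x)
    from N.AE_action[OF g elim(1)] AE_space show ?case
      by eventually_elim (use elim in \<open>simp add: diagonal_action_apply\<close>)
  qed
  then show "AE p in M \<Otimes>\<^sub>M N. D g p \<notin> B"
    by (intro P.AE_pair_measure) auto
qed

text \<open>Integrating out the measure-preserved coordinate gives the function \<open>?F\<close> on
  the first factor, and stationarity there is the claim.\<close>

lemma stationary_diagonal:
  assumes "stationary_G_space G M \<phi> p" and "pmp_G_space G N \<psi>"
  shows "stationary_G_space G (M \<Otimes>\<^sub>M N) D p"
proof (intro stationary_G_space.intro stationary_G_space_axioms.intro G_space_diagonal)
  interpret M: stationary_G_space G M \<phi> p by fact
  interpret N: pmp_G_space G N \<psi> by fact
  interpret D: G_space G "M \<Otimes>\<^sub>M N" D by (rule G_space_diagonal)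
  fix f assume f: "f \<in> Linf (M \<Otimes>\<^sub>M N)"
  then have [measurable]: "f \<in> borel_measurable (M \<Otimes>\<^sub>M N)"
    by (simp add: Linf_iff)
  let ?F = "\<lambda>x. \<integral>y. f (x, y) \<partial>N"
  have "?F \<in> Linf M"
  proof -
    obtain C where C: "AE p in M \<Otimes>\<^sub>M N. \<bar>f p\<bar> \<le> C"
      using f by (auto simp: Linf_iff)
    have "AE x in M. \<bar>?F x\<bar> \<le> C"
      using P.AE_pair[OF C] AE_space
    proof eventually_elim
      case (elim x)
      then have "f \<circ> Pair x \<in> Linf N"
        unfolding Linf_iff comp_def by auto
      then have "integrable N (\<lambda>y. f (x, y))"
        using N.integrable_Linf by (simp add: comp_def)
      then have "(\<integral>y. \<bar>f (x, y)\<bar> \<partial>N) \<le> (\<integral>y. C \<partial>N)"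
        using elim by (intro integral_mono_AE) auto
      then show ?case
        using order_trans[OF integral_abs_bound[of N "\<lambda>y. f (x, y)"]] by (simp add: N.prob_space)
    qed
    then show ?thesis
      by (auto simp: Linf_iff)
  qed
  then have "((\<lambda>s. (\<integral>x. ?F (\<phi> s x) \<partial>M) * pmf p s) has_sum (\<integral>x. ?F x \<partial>M)) (carrier G)"
    by (rule M.stationary)
  then have "((\<lambda>s. (\<integral>x. ?F (\<phi> s x) \<partial>M) * pmf p s) has_sum (\<integral>q. f q \<partial>(M \<Otimes>\<^sub>M N))) (carrier G)"
    unfolding P.integral_fst'[OF prob_space.integrable_Linf[OF P.prob_space_axioms, OF f]] .
  moreover have "(\<integral>x. ?F (\<phi> s x) \<partial>M) = (\<integral>q. f (D s q) \<partial>(M \<Otimes>\<^sub>M N))" if s: "s \<in> carrier G" for s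
  proof -
    \<comment> \<open>Invariance of the measure on \<open>N\<close> allows the missing
      \<open>\<psi> s\<close> to be inserted in the second coordinate.\<close>
    have "(\<integral>y. f (\<phi> s x, y) \<partial>N) = (\<integral>y. f (D s (x, y)) \<partial>N)" if x: "x \<in> space M" for x
    proof -
      have [measurable]: "(\<lambda>y. f (\<phi> s x, y)) \<in> borel_measurable N"
        using M.action_closed[OF s x] by measurable
      have "(\<integral>y. f (\<phi> s x, y) \<partial>N) = (\<integral>y. f (\<phi> s x, y) \<partial>distr N N (\<psi> s))"
        by (simp add: N.measure_preserving[OF s])
      also have "\<dots> = (\<integral>y. f (\<phi> s x, \<psi> s y) \<partial>N)"
        by (rule integral_distr[OF N.action_measurable[OF s]]) measurable
      also have "\<dots> = (\<integral>y. f (D s (x, y)) \<partial>N)"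
        using x by (intro Bochner_Integration.integral_cong) (auto simp: diagonal_action_apply)
      finally show ?thesis .
    qed
    then have "(\<integral>x. ?F (\<phi> s x) \<partial>M) = (\<integral>x. \<integral>y. f (D s (x, y)) \<partial>N \<partial>M)"
      by (rule Bochner_Integration.integral_cong[OF refl])
    also have "\<dots> = (\<integral>q. f (D s q) \<partial>(M \<Otimes>\<^sub>M N))"
      by (rule P.integral_fst'[OF prob_space.integrable_Linf[OF P.prob_space_axioms, OF D.Linf_action[OF s f]]])
    finally show ?thesis .
  qed
  ultimately show "((\<lambda>s. (\<integral>q. f (D s q) \<partial>(M \<Otimes>\<^sub>M N)) * pmf p s) has_sum (\<integral>q. f q \<partial>(M \<Otimes>\<^sub>M N))) (carrier G)"
    by (simp cong: has_sum_cong)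
qed

end

section \<open>Poisson boundaries and ergodicity of products\<close>

lemma (in poisson_boundary) poisson_map_const_imp_AE_const:
  assumes f: "f \<in> Linf M" and const: "\<And>g. g \<in> carrier G \<Longrightarrow> poisson_map G M \<phi> f g = c"
  shows "AE x in M. f x = c"
proof -
  have f_int: "integrable M (\<lambda>x. f (\<phi> g x))" if "g \<in> carrier G" for g
    using Linf_action[OF that f] by (rule integrable_Linf)
  have L: "(\<lambda>x. f x - c) \<in> Linf M"
  proof -
    obtain C where "AE x in M. \<bar>f x\<bar> \<le> C"
      using f by (auto simp: Linf_iff)
    then have "AE x in M. \<bar>f x - c\<bar> \<le> C + \<bar>c\<bar>"
      by eventually_elim auto
    with f show ?thesis
      by (auto simp: Linf_iff)
  qed
  \<comment> \<open>As all translates of the constant c integrate to c, the function f - c has zero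
    transform; the isometry then forces its seminorm to be 0.\<close>
  have "poisson_map G M \<phi> (\<lambda>x. f x - c) g = 0" if "g \<in> carrier G" for g
    using const[OF that] f_int[OF that] that by (simp add: poisson_map_def prob_space)
  then have "Hinf_norm G (poisson_map G M \<phi> (\<lambda>x. f x - c)) = (SUP g\<in>carrier G. 0)"
    unfolding Hinf_norm_def by (intro SUP_cong) auto
  also have "\<dots> = 0"
    using one_closed by (intro cSUP_const) auto
  finally have "AE x in M. f x - c = 0"
    using poisson_map_isometric[OF L] by (intro AE_zero_of_Linf_norm[OF L]) simp
  then show ?thesis by simp
qed

text \<open>The boundary belongs to the adjoint because the transform of a slice is h evaluated
  along inverses: harmonicity for the adjoint then reads as \<open>p\<close>-harmonicity of h on
  \<open>N\<close>, which matches the stationarity there.\<close>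

theorem ergodic_poisson_boundary_times_stationary:
  fixes G :: "('g, 'r) monoid_scheme" (structure)
  assumes "measured_group G p"
    and "poisson_boundary G (adjoint_pmf G p) M \<phi>"
    and "ergodic_G_space G N \<psi>"
    and "stationary_G_space G N \<psi> p"
  shows "ergodic_G_space G (M \<Otimes>\<^sub>M N) (diagonal_action M \<phi> N \<psi>)"
proof -
  interpret measured_group G p by fact
  interpret M: poisson_boundary G "adjoint_pmf G p" M \<phi> by fact
  interpret N: ergodic_G_space G N \<psi> by fact
  interpret N: stationary_G_space G N \<psi> p by fact
  interpret G_space_pair G M \<phi> N \<psi> ..
  interpret D: G_space G "M \<Otimes>\<^sub>M N" D by (rule G_space_diagonal)
  show ?thesis
  proof (intro ergodic_G_space.intro ergodic_G_space_axioms.intro G_space_diagonal)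
    fix B assume B [measurable]: "B \<in> sets (M \<Otimes>\<^sub>M N)"
      and "\<And>g. g \<in> carrier G \<Longrightarrow> sym_diff B (D g ` B) \<in> null_sets (M \<Otimes>\<^sub>M N)"
    then have inv: "AE q in M \<Otimes>\<^sub>M N. D g q \<in> B \<longleftrightarrow> q \<in> B" if "g \<in> carrier G" for g
      using D.invariant_iff_AE[OF B] that by blast
    \<comment> \<open>\<open>F y\<close> is the slice of the indicator of \<open>B\<close> at y, a
      function on the boundary.\<close>
    define F where "F y x = (indicator B (x, y) :: real)" for x y
    define h where "h y = (\<integral>x. F y x \<partial>M)" for y
    have F_meas: "F y \<in> borel_measurable M" if "y \<in> space N" for y
      using that unfolding F_def by measurable
    have F_Linf: "F y \<in> Linf M" if "y \<in> space N" for y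
      using F_meas[OF that] by (auto simp: Linf_iff F_def intro!: exI[of _ 1] split: split_indicator)
    have h_meas: "h \<in> borel_measurable N"
      unfolding h_def F_def by measurable
    have h_bnd: "\<bar>h y\<bar> \<le> 1" if "y \<in> space N" for y
    proof -
      have "(\<integral>x. F y x \<partial>M) \<le> (\<integral>x. 1 \<partial>M)"
        using M.integrable_Linf[OF F_Linf[OF that]]
        by (intro integral_mono) (auto simp: F_def[abs_def] split: split_indicator)
      moreover have "0 \<le> (\<integral>x. F y x \<partial>M)"
        by (simp add: F_def)
      ultimately show ?thesis
        by (simp add: h_def M.prob_space)
    qed
    have "AE y in N. \<forall>g\<in>carrier G. poisson_map G M \<phi> (F y) g = h (\<psi> (inv g) y)"
      unfolding AE_ball_countable[OF countable_carrier]
    proof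
      fix g assume g: "g \<in> carrier G"
      \<comment> \<open>Invariance is used at the point (x, g^-1 y), which \<open>g\<close> sends to
        (gx, y); quasi-invariance of \<open>N\<close> keeps the exceptional set of y null.\<close>
      have "AE y in N. AE x in M. D g (x, \<psi> (inv g) y) \<in> B \<longleftrightarrow> (x, \<psi> (inv g) y) \<in> B"
        by (rule N.AE_action) (use g P.AE_pair_swapped[OF inv[OF g]] in auto)
      then show "AE y in N. poisson_map G M \<phi> (F y) g = h (\<psi> (inv g) y)"
        using AE_space
      proof eventually_elim
        case (elim y)
        then have y': "\<psi> (inv g) y \<in> space N"
          using g by (simp add: N.action_closed)
        from elim(1) AE_space have "AE x in M. F y (\<phi> g x) = F (\<psi> (inv g) y) x"
          by eventually_elim
            (use elim y' g in \<open>simp add: F_def diagonal_action_apply N.action_inv indicator_def\<close>)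
        then show ?case
          using g F_meas[OF y'] measurable_compose[OF M.action_measurable[OF g] F_meas[OF elim(2)]]
          unfolding poisson_map_def h_def restrict_apply'[OF g] by (intro integral_cong_AE)
      qed
    qed
    then have pm: "AE y in N. y \<in> space N \<and> (\<forall>g\<in>carrier G. poisson_map G M \<phi> (F y) g = h (\<psi> (inv g) y))"
      using AE_space by eventually_elim simp
    have "AE y in N. ((\<lambda>s. h (\<psi> s y) * pmf p s) has_sum h y) (carrier G)"
      using pm
    proof eventually_elim
      case (elim y)
      let ?u = "poisson_map G M \<phi> (F y)"
      have u_one: "?u \<one> = h y"
        using elim by (simp add: N.action_one)
      have "?u \<in> Hinf G (adjoint_pmf G p)"
        using M.poisson_map_image F_Linf elim by blast
      \<comment> \<open>Harmonicity is needed only at the identity, where the transform of the slice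
        equals h(y).\<close>
      then have "((\<lambda>s. ?u (\<one> \<otimes> s) * pmf (adjoint_pmf G p) s) has_sum ?u \<one>) (carrier G)"
        unfolding Hinf_def by blast
      then have "((\<lambda>s. h (\<psi> (inv s) y) * pmf p (inv s)) has_sum h y) (carrier G)"
        using elim unfolding u_one by (simp add: pmf_adjoint_pmf[OF support_subset] cong: has_sum_cong)
      then show ?case
        \<comment> \<open>Substituting the inverse of s turns the adjoint weights back into those of
          \<open>p\<close>.\<close>
        using has_sum_reindex_bij_betw[OF inv_bij_betw, of "\<lambda>s. h (\<psi> s y) * pmf p s"] by simp
    qed
    then have "AE y in N. h (\<psi> g y) = h y" if "g \<in> carrier G" for g
      using N.harmonic_imp_AE_invariant[OF assms(1) h_meas h_bnd] that by blast
    moreover have "integrable N h"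
      using h_meas h_bnd by (intro N.integrable_Linf) (auto simp: Linf_iff intro!: exI[of _ 1])
    ultimately obtain c where "AE y in N. h y = c"
      using N.invariant_imp_AE_const[of h] by blast
    then have "AE y in N. h (\<psi> (inv g) y) = c" if "g \<in> carrier G" for g
      using N.AE_action[of "inv g" "\<lambda>y. h y = c"] that by simp
    then have "AE y in N. \<forall>g\<in>carrier G. h (\<psi> (inv g) y) = c"
      by (simp add: AE_ball_countable[OF countable_carrier])
    \<comment> \<open>For almost every y the slice now has a transform identically c, so the slice
      itself is almost everywhere c.\<close>
    with pm have F_const: "AE y in N. AE x in M. F y x = c"
      by eventually_elim (intro M.poisson_map_const_imp_AE_const F_Linf, auto)
    \<comment> \<open>An indicator takes no other value, and neither probability space is
      null.\<close>
    have "c = 0 \<or> c = 1"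
    proof (rule ccontr)
      assume c: "\<not> (c = 0 \<or> c = 1)"
      have "AE y in N. AE x in M. False"
        using F_const
      proof eventually_elim
        case (elim y)
        then show ?case
          by eventually_elim (use c in \<open>auto simp: F_def split: split_indicator_asm\<close>)
      qed
      then show False
        by simp
    qed
    then have "(AE y in N. AE x in M. (x, y) \<notin> B) \<or> (AE y in N. AE x in M. (x, y) \<in> B)"
    proof
      assume "c = 0"
      then have "AE y in N. AE x in M. (x, y) \<notin> B"
        using F_const by (simp add: F_def indicator_eq_0_iff)
      then show ?thesis ..
    next
      assume "c = 1"
      then have "AE y in N. AE x in M. (x, y) \<in> B"
        using F_const by (simp add: F_def indicator_eq_1_iff)
      then show ?thesis ..
    qed
    \<comment> \<open>As \<open>B\<close> is measurable, the slicewise statements may be reordered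
      and assembled on the product.\<close>
    then have "(AE q in M \<Otimes>\<^sub>M N. q \<notin> B) \<or> (AE q in M \<Otimes>\<^sub>M N. q \<in> B)"
      using P.AE_commute[of "\<lambda>x y. (x, y) \<notin> B"] P.AE_commute[of "\<lambda>x y. (x, y) \<in> B"]
        P.AE_pair_measure[of "\<lambda>q. q \<notin> B"] P.AE_pair_measure[of "\<lambda>q. q \<in> B"]
      by simp blast
    moreover have "{q \<in> space (M \<Otimes>\<^sub>M N). q \<in> B} = B"
      using sets.sets_into_space[OF B] by auto
    ultimately show "B \<in> null_sets (M \<Otimes>\<^sub>M N) \<or> space (M \<Otimes>\<^sub>M N) - B \<in> null_sets (M \<Otimes>\<^sub>M N)"
      by (auto simp: AE_iff_null set_diff_eq)
  qed
qed

theorem corollary3p2: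
  fixes G :: "('g, 'r) monoid_scheme"
    and \<mu> :: "'g pmf"
    and Z :: "'z measure" and \<phi> :: "'g \<Rightarrow> 'z \<Rightarrow> 'z"
    and Z' :: "'w measure" and \<phi>' :: "'g \<Rightarrow> 'w \<Rightarrow> 'w"
    and Y :: "'y measure" and \<psi> :: "'g \<Rightarrow> 'y \<Rightarrow> 'y"
  assumes "measured_group G \<mu>"
    and "poisson_boundary G \<mu> Z \<phi>"
    and "poisson_boundary G (adjoint_pmf G \<mu>) Z' \<phi>'"
    and "ergodic_G_space G Y \<psi>"
    and "pmp_G_space G Y \<psi>"
  shows "ergodic_G_space G (Z \<Otimes>\<^sub>M Z' \<Otimes>\<^sub>M Y)
           (diagonal_action Z \<phi> (Z' \<Otimes>\<^sub>M Y) (diagonal_action Z' \<phi>' Y \<psi>))"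
proof -
  interpret measured_group G \<mu> by fact
  interpret Y: pmp_G_space G Y \<psi> by fact
  interpret Z': poisson_boundary G "adjoint_pmf G \<mu>" Z' \<phi>' by fact
  interpret Z'Y: G_space_pair G Z' \<phi>' Y \<psi> ..
  show ?thesis
  \<comment> \<open>The outer application uses the adjoint of \<open>\<mu>\<close> as its measure,
    so that \<open>Z\<close> is the boundary of the adjoint of that measure.\<close>
  proof (rule ergodic_poisson_boundary_times_stationary)
    show "measured_group G (adjoint_pmf G \<mu>)"
      by (rule Z'.measured_group_axioms)
    show "poisson_boundary G (adjoint_pmf G (adjoint_pmf G \<mu>)) Z \<phi>"
      using assms(2) by (simp add: adjoint_adjoint_pmf support_subset)
    \<comment> \<open>The inner application uses \<open>\<mu>\<close> itself; \<open>Y\<close> is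
      stationary for it, being measure-preserving.\<close>
    show "ergodic_G_space G (Z' \<Otimes>\<^sub>M Y) Z'Y.D"
      using assms(1,3,4) Y.pmp_stationary[OF support_subset]
      by (rule ergodic_poisson_boundary_times_stationary)
    \<comment> \<open>The boundary \<open>Z'\<close> is stationary for the adjoint measure, and the
      factor \<open>Y\<close> preserves this.\<close>
    show "stationary_G_space G (Z' \<Otimes>\<^sub>M Y) Z'Y.D (adjoint_pmf G \<mu>)"
      using Z'.stationary_G_space_axioms assms(5) by (rule Z'Y.stationary_diagonal)
  qed
qed

end
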